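(* For each $n\ge3$, there exists an $n$-chain group with a non-simple commutator subgroup.
   Context: $\mathrm{Homeo}^+(\mathbb{R})$ is the group of orientation preserving homeomorphisms of $\mathbb{R}$; $\operatorname{supp} f=\{x: f(x)\ne x\}$. For an interval $J$, $\partial^-J$ is its left endpoint. Chain of intervals: a collection $\{J_1,\ldots,J_n\}$ of nonempty open subintervals of $\mathbb{R}$ (possibly unbounded) such that $J_i\cap J_k=\varnothing$ if $|i-k|>1$, and $J_i\cap J_{i+1}$ is a proper nonempty subinterval of both $J_i$ and $J_{i+1}$ for $1\le i\le n-1$. $n$-chain group ($n\ge 2$): a group $\langle f_1,\ldots,f_n\rangle\le\mathrm{Homeo}^+(\mathbb{R})$ where $\{\operatorname{supp} f_1,\dots,\operatorname{supp} f_n\}$ is a chain of intervals with $\partial^-\operatorname{supp} f_i<\partial^-\operatorname{supp} f_{i+1}$ for all $i<n$, $f_i(t)\ge t$ for all $t$ and $i$, and $\langle f_i,f_{i+1}\rangle\cong F$ for each $1\le i\le n-1$. Here $F=\langle \{g_i\}_{i\ge0}\mid g_i^{-1}g_jg_i=g_{j+1}\text{ for }0\le i<j\rangle$ is Thompson's group. *)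

theory Defs
  imports "HOL-Analysis.Analysis" "HOL-Algebra.Generated_Groups"
begin

section \<open>Groups given by generators and relations\<close>

text \<open>A word over generators of type \<open>'g\<close> is a list of signed letters: \<open>(x, True)\<close> stands for
  \<open>x\<close> and \<open>(x, False)\<close> for the inverse of \<open>x\<close>. A relation \<open>u = v\<close> is the pair \<open>(u, v)\<close>.\<close>

type_synonym 'g word = "('g \<times> bool) list"

inductive word_eq :: "('g word \<times> 'g word) set \<Rightarrow> 'g word \<Rightarrow> 'g word \<Rightarrow> bool"
  for R :: "('g word \<times> 'g word) set"
where
  refl: "word_eq R u u"
| sym: "word_eq R u v \<Longrightarrow> word_eq R v u"
| trans: "word_eq R u v \<Longrightarrow> word_eq R v w \<Longrightarrow> word_eq R u w"
| append: "word_eq R u u' \<Longrightarrow> word_eq R v v' \<Longrightarrow> word_eq R (u @ v) (u' @ v')"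
| cancel: "word_eq R [(x, b), (x, \<not> b)] []"
| relation: "(u, v) \<in> R \<Longrightarrow> word_eq R u v"

text \<open>The generators are all elements of the type \<open>'g\<close>.\<close>

definition presented_group :: "('g word \<times> 'g word) set \<Rightarrow> 'g word set monoid" where
  "presented_group R =
    \<lparr>carrier = UNIV // {(u, v). word_eq R u v},
     mult = (\<lambda>A B. \<Union>u\<in>A. \<Union>v\<in>B. {w. word_eq R (u @ v) w}),
     one = {w. word_eq R [] w}\<rparr>"

lemma presented_group_mult_class:
  "{w. word_eq R u w} \<otimes>\<^bsub>presented_group R\<^esub> {w. word_eq R v w} = {w. word_eq R (u @ v) w}"
proof -
  have "word_eq R (u @ v) w"
    if "word_eq R u u'" "word_eq R v v'" "word_eq R (u' @ v') w" for u' v' w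
    using word_eq.append[OF that(1,2)] that(3) by (rule word_eq.trans)
  then show ?thesis
    unfolding presented_group_def by (auto intro: word_eq.refl)
qed

lemma presented_group_carrier:
  "A \<in> carrier (presented_group R) \<longleftrightarrow> (\<exists>u. A = {w. word_eq R u w})"
  unfolding presented_group_def quotient_def by auto

lemma word_eq_left_inverse:
  "word_eq R (map (\<lambda>(x, b). (x, \<not> b)) (rev u) @ u) []"
proof (induction u)
  case Nil
  show ?case by (simp add: word_eq.refl)
next
  case (Cons a u)
  obtain x b where a: "a = (x, b)" by fastforce
  let ?i = "map (\<lambda>(x, b). (x, \<not> b)) (rev u)"
  have "word_eq R ([(x, \<not> b), (x, b)] @ u) ([] @ u)"
    using word_eq.append[OF word_eq.cancel[of R x "\<not> b"] word_eq.refl[of R u]] by simp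
  then have "word_eq R (?i @ ([(x, \<not> b), (x, b)] @ u)) (?i @ ([] @ u))"
    by (rule word_eq.append[OF word_eq.refl])
  then show ?case
    using word_eq.trans[OF _ Cons.IH] a by simp
qed

lemma group_presented_group: "group (presented_group R)"
proof (rule groupI)
  let ?G = "presented_group R"
  have one: "\<one>\<^bsub>?G\<^esub> = {w. word_eq R [] w}"
    by (simp add: presented_group_def)
  show "\<one>\<^bsub>?G\<^esub> \<in> carrier ?G"
    using one presented_group_carrier by blast
  fix A assume "A \<in> carrier ?G"
  then obtain u where A: "A = {w. word_eq R u w}"
    using presented_group_carrier by blast
  show "\<one>\<^bsub>?G\<^esub> \<otimes>\<^bsub>?G\<^esub> A = A"
    by (simp add: A one presented_group_mult_class)
  let ?i = "map (\<lambda>(x, b). (x, \<not> b)) (rev u)"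
  have "{w. word_eq R (?i @ u) w} = {w. word_eq R [] w}"
    using word_eq_left_inverse[of R u] by (blast intro: word_eq.sym word_eq.trans)
  then have "{w. word_eq R ?i w} \<otimes>\<^bsub>?G\<^esub> A = \<one>\<^bsub>?G\<^esub>"
    by (simp only: A one presented_group_mult_class)
  moreover have "{w. word_eq R ?i w} \<in> carrier ?G"
    using presented_group_carrier by blast
  ultimately show "\<exists>B\<in>carrier ?G. B \<otimes>\<^bsub>?G\<^esub> A = \<one>\<^bsub>?G\<^esub>"
    by blast
  fix B assume "B \<in> carrier ?G"
  then obtain v where B: "B = {w. word_eq R v w}"
    using presented_group_carrier by blast
  show "A \<otimes>\<^bsub>?G\<^esub> B \<in> carrier ?G"
    using presented_group_carrier[of _ R] by (auto simp: A B presented_group_mult_class)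
  fix C assume "C \<in> carrier ?G"
  then obtain w where C: "C = {x. word_eq R w x}"
    using presented_group_carrier by blast
  show "A \<otimes>\<^bsub>?G\<^esub> B \<otimes>\<^bsub>?G\<^esub> C = A \<otimes>\<^bsub>?G\<^esub> (B \<otimes>\<^bsub>?G\<^esub> C)"
    by (simp add: A B C presented_group_mult_class)
qed

text \<open>The generator \<open>g\<^sub>i\<close> is the letter \<open>i\<close>.\<close>

definition Thompson_F :: "nat word set monoid" where
  "Thompson_F = presented_group
    {([(i, False), (j, True), (i, True)], [(j + 1, True)]) | i j. i < j}"


section \<open>Homeomorphisms of the line\<close>

text \<open>A homeomorphism of the line preserves orientation iff it is increasing.\<close>

definition Homeo_plus :: "(real \<Rightarrow> real) monoid" where
  "Homeo_plus =
    \<lparr>carrier = {f. (\<exists>g. homeomorphism UNIV UNIV f g) \<and> strict_mono f},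
     mult = (\<circ>),
     one = id\<rparr>"

lemma group_Homeo_plus: "group Homeo_plus"
proof (rule groupI)
  show "\<one>\<^bsub>Homeo_plus\<^esub> \<in> carrier Homeo_plus"
    by (auto simp: Homeo_plus_def strict_mono_def homeomorphism_def
        intro!: exI[of _ id] continuous_on_id')
  fix f assume "f \<in> carrier Homeo_plus"
  then obtain g where f: "homeomorphism UNIV UNIV f g" "strict_mono f"
    by (auto simp: Homeo_plus_def)
  show "\<one>\<^bsub>Homeo_plus\<^esub> \<otimes>\<^bsub>Homeo_plus\<^esub> f = f"
    by (simp add: Homeo_plus_def)
  have fg: "f (g y) = y" "g (f y) = y" for y
    using f(1) by (auto simp: homeomorphism_def)
  have "strict_mono g"
    using strict_mono_less[OF f(2)] fg by (metis strict_monoI)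
  then have "g \<in> carrier Homeo_plus"
    using homeomorphism_symD[OF f(1)] by (auto simp: Homeo_plus_def)
  then show "\<exists>h\<in>carrier Homeo_plus. h \<otimes>\<^bsub>Homeo_plus\<^esub> f = \<one>\<^bsub>Homeo_plus\<^esub>"
    using fg by (auto simp: Homeo_plus_def fun_eq_iff)
  fix h assume "h \<in> carrier Homeo_plus"
  then obtain h' where h: "homeomorphism UNIV UNIV h h'" "strict_mono h"
    by (auto simp: Homeo_plus_def)
  show "f \<otimes>\<^bsub>Homeo_plus\<^esub> h \<in> carrier Homeo_plus"
    using homeomorphism_compose[OF h(1) f(1)] strict_monoD[OF f(2)] strict_monoD[OF h(2)]
    by (auto simp: Homeo_plus_def intro!: strict_monoI)
  fix k assume "k \<in> carrier Homeo_plus"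
  show "f \<otimes>\<^bsub>Homeo_plus\<^esub> h \<otimes>\<^bsub>Homeo_plus\<^esub> k = f \<otimes>\<^bsub>Homeo_plus\<^esub> (h \<otimes>\<^bsub>Homeo_plus\<^esub> k)"
    by (simp add: Homeo_plus_def comp_assoc)
qed

definition supp :: "(real \<Rightarrow> real) \<Rightarrow> real set" where
  "supp f = {x. f x \<noteq> x}"


section \<open>Chain groups\<close>

definition chain_of_intervals :: "nat \<Rightarrow> (nat \<Rightarrow> real set) \<Rightarrow> bool" where
  "chain_of_intervals n J \<longleftrightarrow>
    (\<forall>i\<in>{1..n}. J i \<noteq> {} \<and> open (J i) \<and> is_interval (J i)) \<and>
    (\<forall>i\<in>{1..n}. \<forall>k\<in>{1..n}. \<bar>int i - int k\<bar> > 1 \<longrightarrow> J i \<inter> J k = {}) \<and>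
    (\<forall>i. 1 \<le> i \<and> i < n \<longrightarrow>
      J i \<inter> J (i + 1) \<noteq> {} \<and> is_interval (J i \<inter> J (i + 1)) \<and>
      J i \<inter> J (i + 1) \<subset> J i \<and> J i \<inter> J (i + 1) \<subset> J (i + 1))"

text \<open>The left endpoint is an extended real, since it is \<open>-\<infinity>\<close> for an interval unbounded below.\<close>

definition left_endpoint :: "real set \<Rightarrow> ereal" where
  "left_endpoint J = (INF x\<in>J. ereal x)"

text \<open>The \<open>n\<close>-chain groups, as subgroups (carrier sets) of \<^const>\<open>Homeo_plus\<close>.\<close>

definition chain_group :: "nat \<Rightarrow> (real \<Rightarrow> real) set \<Rightarrow> bool" where
  "chain_group n G \<longleftrightarrow>
    n \<ge> 2 \<and>
    (\<exists>f :: nat \<Rightarrow> real \<Rightarrow> real.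
      (\<forall>i\<in>{1..n}. f i \<in> carrier Homeo_plus) \<and>
      G = generate Homeo_plus (f ` {1..n}) \<and>
      chain_of_intervals n (\<lambda>i. supp (f i)) \<and>
      (\<forall>i. 1 \<le> i \<and> i < n \<longrightarrow> left_endpoint (supp (f i)) < left_endpoint (supp (f (i + 1)))) \<and>
      (\<forall>i\<in>{1..n}. \<forall>t. f i t \<ge> t) \<and>
      (\<forall>i. 1 \<le> i \<and> i < n \<longrightarrow>
        Homeo_plus\<lparr>carrier := generate Homeo_plus {f i, f (i + 1)}\<rparr> \<cong> Thompson_F))"

lemma chain_group_subgroup: "chain_group n G \<Longrightarrow> subgroup G Homeo_plus"
  unfolding chain_group_def
  by (auto intro!: group.generate_is_subgroup[OF group_Homeo_plus])


section \<open>Simple groups\<close>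

text \<open>The locale \<open>simple_group\<close> of \<open>HOL-Algebra\<close> requires \<open>order G > 1\<close>, where \<open>order\<close> is a
  cardinality in \<open>nat\<close> and hence \<open>0\<close> for infinite groups, so it only covers finite groups.
  Here nontriviality is stated without reference to the order.\<close>

definition is_simple_group :: "('a, 'b) monoid_scheme \<Rightarrow> bool" where
  "is_simple_group G \<longleftrightarrow>
    group G \<and> carrier G \<noteq> {\<one>\<^bsub>G\<^esub>} \<and>
    (\<forall>N. N \<lhd> G \<longrightarrow> N = carrier G \<or> N = {\<one>\<^bsub>G\<^esub>})"

text \<open>Hence the negation of \<^const>\<open>is_simple_group\<close> is never due to a failure of the group
  axioms when applied to the commutator subgroup of a chain group.\<close>

lemma group_derived_chain_group:
  assumes "chain_group n G"
  shows "group (Homeo_plus\<lparr>carrier := derived Homeo_plus G\<rparr>)"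
  using group.derived_is_subgroup[OF group_Homeo_plus] group.subgroup_imp_group[OF group_Homeo_plus]
    subgroup.subset[OF chain_group_subgroup[OF assms]] by blast

end

theory Submission
  imports Defs
begin

text \<open>A chain group with a non-simple commutator subgroup arises from one that preserves a
  Cantor set \<open>C\<close>: the elements of the commutator subgroup that fix \<open>C\<close> pointwise form a normal
  subgroup, which is proper because commutators move \<open>C\<close>, and the task is to make it nontrivial.

  The generators are translates by \<open>18\<close> of one piecewise linear map, the triadic analogue of the
  standard generator of \<open>F\<close>; \<open>C\<close> consists of translates of the (rescaled) middle-thirds set.
  Being a copy of \<open>F\<close> is a purely dynamical condition on two neighbouring generators (the ping-pong
  inequality \<open>g (f b) \<ge> c\<close>), so it survives a change of the map inside one gap of \<open>C\<close>. The
  unperturbed generators satisfy a relation involving three consecutive ones that does not follow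
  from the relations between neighbours and the commutation of disjoint generators. Perturbing the
  map in the gap \<open>(1, 2)\<close> destroys the relation in a gap while keeping it on \<open>C\<close>. Both sides of the
  relation are commutators, so their quotient is the required element.\<close>

section \<open>Evaluating words in a group\<close>

primrec eval_word :: "('a, 'b) monoid_scheme \<Rightarrow> ('g \<Rightarrow> 'a) \<Rightarrow> 'g word \<Rightarrow> 'a" where
  "eval_word G x [] = \<one>\<^bsub>G\<^esub>"
| "eval_word G x (l # w) =
    (if snd l then x (fst l) else inv\<^bsub>G\<^esub> (x (fst l))) \<otimes>\<^bsub>G\<^esub> eval_word G x w"

context group
begin

lemma eval_word_closed:
  assumes "range x \<subseteq> carrier G"
  shows "eval_word G x w \<in> carrier G"
  using assms by (induction w) (auto simp: image_subset_iff)

lemma eval_word_append: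
  assumes "range x \<subseteq> carrier G"
  shows "eval_word G x (u @ v) = eval_word G x u \<otimes> eval_word G x v"
  using assms
  by (induction u) (auto simp: image_subset_iff eval_word_closed m_assoc)

lemma eval_word_cong:
  assumes x: "range x \<subseteq> carrier G"
    and R: "\<And>u v. (u, v) \<in> R \<Longrightarrow> eval_word G x u = eval_word G x v"
    and "word_eq R u v"
  shows "eval_word G x u = eval_word G x v"
  using \<open>word_eq R u v\<close>
proof induction
  case (cancel i b)
  then show ?case using x by (auto simp: image_subset_iff)
qed (auto simp: eval_word_append[OF x] R)

lemma eval_word_in_generate: "eval_word G x w \<in> generate G (range x)"
proof (induction w)
  case (Cons l w)
  have "x (fst l) \<in> generate G (range x)" "inv (x (fst l)) \<in> generate G (range x)"
    by (auto intro: generate.intros)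
  then show ?case using Cons by (auto intro: generate.eng)
qed (simp add: generate.one)

lemma generate_eval_word:
  assumes x: "range x \<subseteq> carrier G" and "g \<in> generate G (range x)"
  shows "\<exists>w. g = eval_word G x w"
  using assms(2)
proof induction
  case one
  show ?case by (rule exI[of _ "[]"]) simp
next
  case (incl h)
  then obtain i where "h = x i" by auto
  then have "h = eval_word G x [(i, True)]" using x by (auto simp: image_subset_iff)
  then show ?case by blast
next
  case (inv h)
  then obtain i where "h = x i" by auto
  then have "inv h = eval_word G x [(i, False)]" using x by (auto simp: image_subset_iff)
  then show ?case by blast
next
  case (eng h1 h2)
  then show ?case by (metis eval_word_append[OF x])
qed

text \<open>By \<open>R\<close> evaluation is constant on the classes of \<open>word_eq R\<close>
  and so induces a homomorphism from the presented group. It is injective by \<open>ker\<close>, and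
  words reach every element of \<open>generate G (range x)\<close>.\<close>

lemma presented_group_iso:
  fixes x :: "'g \<Rightarrow> 'a"
  assumes x: "range x \<subseteq> carrier G"
    and R: "\<And>u v. (u, v) \<in> R \<Longrightarrow> eval_word G x u = eval_word G x v"
    and ker: "\<And>w. eval_word G x w = \<one> \<Longrightarrow> word_eq R w []"
  shows "G\<lparr>carrier := generate G (range x)\<rparr> \<cong> presented_group R"
proof -
  let ?P = "presented_group R" and ?H = "G\<lparr>carrier := generate G (range x)\<rparr>"
  let ?cls = "\<lambda>u. {w. word_eq R u w}"
  \<comment> \<open>Any representative may be chosen: by \<open>eval_word_cong\<close> the value
    does not depend on it.\<close>
  define h where "h A = eval_word G x (SOME u. u \<in> A)" for A
  have h: "h (?cls u) = eval_word G x u" for u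
  proof -
    have "(SOME w. w \<in> ?cls u) \<in> ?cls u"
      by (rule someI[of _ u]) (simp add: word_eq.refl)
    then show ?thesis unfolding h_def using eval_word_cong[OF x R] by (metis mem_Collect_eq)
  qed
  have inj: "word_eq R u v" if e: "eval_word G x u = eval_word G x v" for u v
  proof -
    let ?i = "map (\<lambda>(x, b). (x, \<not> b)) (rev u)"
    have "eval_word G x (?i @ v) = eval_word G x (?i @ u)"
      using e by (simp add: eval_word_append[OF x])
    also have "\<dots> = \<one>"
      using eval_word_cong[OF x R word_eq_left_inverse] by simp
    finally have iv: "word_eq R (?i @ v) []" by (rule ker)
    have "word_eq R (u @ ?i) []"
      using word_eq_left_inverse[of R ?i]
      by (simp add: rev_map case_prod_beta comp_def)
    then have "word_eq R (u @ ?i @ v) v"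
      using word_eq.append[OF _ word_eq.refl, of R "u @ ?i" "[]" v] by simp
    moreover have "word_eq R (u @ ?i @ v) u"
      using word_eq.append[OF word_eq.refl iv, of u] by simp
    ultimately show ?thesis by (blast intro: word_eq.sym word_eq.trans)
  qed
  have "h \<in> iso ?P ?H"
  proof (rule isoI)
    show "h \<in> hom ?P ?H"
    proof (rule homI)
      fix A B assume "A \<in> carrier ?P" "B \<in> carrier ?P"
      then obtain u v where "A = ?cls u" "B = ?cls v"
        using presented_group_carrier by metis
      then show "h (A \<otimes>\<^bsub>?P\<^esub> B) = h A \<otimes>\<^bsub>?H\<^esub> h B"
        by (simp add: presented_group_mult_class h eval_word_append[OF x])
    qed (simp add: h_def eval_word_in_generate)
    show "bij_betw h (carrier ?P) (carrier ?H)"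
      unfolding bij_betw_def
    proof
      show "inj_on h (carrier ?P)"
      proof (rule inj_onI)
        fix A B assume AB: "A \<in> carrier ?P" "B \<in> carrier ?P" "h A = h B"
        then obtain u v where uv: "A = ?cls u" "B = ?cls v"
          using presented_group_carrier by metis
        then have "word_eq R u v" using AB(3) h inj by simp
        then show "A = B" unfolding uv by (blast intro: word_eq.sym word_eq.trans)
      qed
      show "h ` carrier ?P = carrier ?H"
      proof safe
        fix A show "h A \<in> carrier ?H" by (simp add: h_def eval_word_in_generate)
      next
        fix g assume "g \<in> carrier ?H"
        then obtain u where "g = eval_word G x u"
          using generate_eval_word[OF x] by auto
        then have "g = h (?cls u)" by (simp add: h)
        then show "g \<in> h ` carrier ?P" using presented_group_carrier by blast
      qed
    qed
  qed
  then show ?thesis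
    using group.iso_sym[OF group_presented_group] unfolding is_iso_def by blast
qed

end

section \<open>Fractions in Thompson's group\<close>

abbreviation Thompson_rels :: "(nat word \<times> nat word) set" where
  "Thompson_rels \<equiv> {([(i, False), (j, True), (i, True)], [(j + 1, True)]) | i j. i < j}"

abbreviation thompson_eq :: "nat word \<Rightarrow> nat word \<Rightarrow> bool" (infix "\<approx>\<^sub>F" 50) where
  "u \<approx>\<^sub>F v \<equiv> word_eq Thompson_rels u v"

abbreviation pos :: "nat list \<Rightarrow> nat word" where
  "pos p \<equiv> map (\<lambda>i. (i, True)) p"

abbreviation neg :: "nat list \<Rightarrow> nat word" where
  "neg p \<equiv> map (\<lambda>i. (i, False)) p"

declare word_eq.trans [trans]

lemma word_eq_context: "word_eq R u v \<Longrightarrow> word_eq R (a @ u @ b) (a @ v @ b)"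
  by (intro word_eq.append word_eq.refl)

lemma word_eq_insert: "word_eq R (a @ b) (a @ [(i, c), (i, \<not> c)] @ b)"
  using word_eq_context[OF word_eq.sym[OF word_eq.cancel[of R i c]], of a b] by simp

lemma thompson_relation: "i < j \<Longrightarrow> [(i, False), (j, True), (i, True)] \<approx>\<^sub>F [(j + 1, True)]"
  by (rule word_eq.relation) blast

lemma thompson_swap:
  assumes "i < j"
  shows "[(j, True), (i, True)] \<approx>\<^sub>F [(i, True), (j + 1, True)]"
proof -
  have "[(j, True), (i, True)] \<approx>\<^sub>F [(i, True), (i, False), (j, True), (i, True)]"
    using word_eq_insert[of _ "[]" "[(j, True), (i, True)]" i True] by simp
  also have "\<dots> \<approx>\<^sub>F [(i, True), (j + 1, True)]"
    using word_eq_context[OF thompson_relation[OF assms], of "[(i, True)]" "[]"] by simp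
  finally show ?thesis .
qed

lemma thompson_inv_less:
  assumes "i < j"
  shows "[(i, False), (j, True)] \<approx>\<^sub>F [(j + 1, True), (i, False)]"
proof -
  have "[(i, False), (j, True)] \<approx>\<^sub>F [(i, False), (j, True), (i, True), (i, False)]"
    using word_eq_insert[of _ "[(i, False), (j, True)]" "[]" i True] by simp
  also have "\<dots> \<approx>\<^sub>F [(j + 1, True), (i, False)]"
    using word_eq_context[OF thompson_relation[OF assms], of "[]" "[(i, False)]"] by simp
  finally show ?thesis .
qed

lemma thompson_inv_greater:
  assumes "i < j"
  shows "[(j, False), (i, True)] \<approx>\<^sub>F [(i, True), (j + 1, False)]"
proof -
  have "[(j, False), (i, True)] \<approx>\<^sub>F [(j, False), (i, True), (j + 1, True), (j + 1, False)]"
    using word_eq_insert[of _ "[(j, False), (i, True)]" "[]" "j + 1" True] by simp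
  also have "\<dots> \<approx>\<^sub>F [(j, False), (j, True), (i, True), (j + 1, False)]"
    using word_eq_context[OF word_eq.sym[OF thompson_swap[OF assms]],
        of "[(j, False)]" "[(j + 1, False)]"] by simp
  also have "\<dots> \<approx>\<^sub>F [(i, True), (j + 1, False)]"
    using word_eq.sym[OF word_eq_insert[of _ "[]" "[(i, True), (j + 1, False)]" j False]] by simp
  finally show ?thesis .
qed

text \<open>The inverse letter travels right through \<open>p\<close>: it cancels against its own
  positive letter, and otherwise the larger of the two indices grows by one. Its index may thus
  change on the way, so the induction generalises over \<open>i\<close>.\<close>

lemma inv_pos_fraction: "\<exists>p' r. (i, False) # pos p \<approx>\<^sub>F pos p' @ neg r"
proof (induction p arbitrary: i)
  case Nil
  have "(i, False) # pos [] \<approx>\<^sub>F pos [] @ neg [i]" by (simp add: word_eq.refl)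
  then show ?case by blast
next
  case (Cons j p)
  have step: ?case if "[(i, False), (j, True)] \<approx>\<^sub>F [(j', True), (i', False)]" for i' j'
  proof -
    obtain p' r where IH: "(i', False) # pos p \<approx>\<^sub>F pos p' @ neg r" using Cons by blast
    have "(i, False) # pos (j # p) \<approx>\<^sub>F (j', True) # (i', False) # pos p"
      using word_eq_context[OF that, of "[]" "pos p"] by simp
    also have "\<dots> \<approx>\<^sub>F pos (j' # p') @ neg r"
      using word_eq.append[OF word_eq.refl IH, of "[(j', True)]"] by simp
    finally show ?thesis by blast
  qed
  consider "i = j" | "i < j" | "j < i" by linarith
  then show ?case
  proof cases
    case 1
    then have "(i, False) # pos (j # p) \<approx>\<^sub>F pos p @ neg []"
      using word_eq.sym[OF word_eq_insert[of _ "[]" "pos p" i False]] by simp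
    then show ?thesis by blast
  qed (use step thompson_inv_less thompson_inv_greater in blast)+
qed

lemma thompson_fraction: "\<exists>p q. w \<approx>\<^sub>F pos p @ neg q"
proof (induction w)
  case Nil
  have "[] \<approx>\<^sub>F pos [] @ neg []" by (simp add: word_eq.refl)
  then show ?case by blast
next
  case (Cons l w)
  obtain i b where l: "l = (i, b)" by fastforce
  obtain p q where IH: "w \<approx>\<^sub>F pos p @ neg q" using Cons by blast
  have lw: "l # w \<approx>\<^sub>F l # pos p @ neg q"
    using word_eq.append[OF word_eq.refl IH, of "[l]"] by simp
  show ?case
  proof (cases b)
    case True
    then have "l # w \<approx>\<^sub>F pos (i # p) @ neg q" using lw l by simp
    then show ?thesis by blast
  next
    case False
    obtain p' r where "(i, False) # pos p \<approx>\<^sub>F pos p' @ neg r" using inv_pos_fraction by blast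
    then have "l # pos p @ neg q \<approx>\<^sub>F pos p' @ neg (r @ q)"
      using word_eq.append[OF _ word_eq.refl, of _ _ _ "neg q"] l False by fastforce
    then show ?thesis using word_eq.trans[OF lw] by blast
  qed
qed

text \<open>Moving the least letter left past a larger one only raises the index of the latter. The
  length is tracked for the induction in \<open>Thompson_F_criterion\<close>.\<close>

lemma thompson_min_first:
  assumes "k \<in> set p" "\<forall>j\<in>set p. k \<le> j"
  shows "\<exists>p'. length p = Suc (length p') \<and> pos p \<approx>\<^sub>F pos (k # p')"
  using assms
proof (induction p)
  case (Cons j p)
  show ?case
  proof (cases "j = k")
    case True
    then show ?thesis by (auto intro: word_eq.refl)
  next
    case False
    then obtain p' where p': "length p = Suc (length p')" "pos p \<approx>\<^sub>F pos (k # p')"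
      using Cons by auto
    have "pos (j # p) \<approx>\<^sub>F [(j, True), (k, True)] @ pos p'"
      using word_eq.append[OF word_eq.refl p'(2), of "[(j, True)]"] by simp
    also have "\<dots> \<approx>\<^sub>F pos (k # Suc j # p')"
      using word_eq_context[OF thompson_swap, of k j "[]" "pos p'"] False Cons.prems by simp
    finally show ?thesis using p'(1) by (intro exI[of _ "Suc j # p'"]) simp
  qed
qed simp

section \<open>Recognising Thompson's group\<close>

interpretation Homeo: group Homeo_plus
  by (rule group_Homeo_plus)

lemma Homeo_plus_mult [simp]: "f \<otimes>\<^bsub>Homeo_plus\<^esub> g = f \<circ> g"
  and Homeo_plus_one [simp]: "\<one>\<^bsub>Homeo_plus\<^esub> = id"
  by (simp_all add: Homeo_plus_def)

lemma Homeo_plus_strict_mono: "f \<in> carrier Homeo_plus \<Longrightarrow> strict_mono f"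
  by (simp add: Homeo_plus_def)

lemma Homeo_plus_inv_apply [simp]:
  assumes "f \<in> carrier Homeo_plus"
  shows "f ((inv\<^bsub>Homeo_plus\<^esub> f) x) = x" "(inv\<^bsub>Homeo_plus\<^esub> f) (f x) = x"
  using Homeo.r_inv[OF assms] Homeo.l_inv[OF assms] by (simp_all add: fun_eq_iff)

text \<open>By cancelling the least letter, equality of positive words is detected at a point that this
  letter moves and all later ones fix.\<close>

lemma Thompson_F_criterion:
  assumes X: "range X \<subseteq> carrier Homeo_plus"
    and rel: "\<And>i j. i < j \<Longrightarrow> X j \<circ> X i = X i \<circ> X (Suc j)"
    and le: "\<And>i t. X i t \<le> t"
    and moves: "\<And>k. \<exists>t. X k t < t \<and> (\<forall>j>k. X j t = t)"
  shows "Homeo_plus\<lparr>carrier := generate Homeo_plus (range X)\<rparr> \<cong> Thompson_F"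
  unfolding Thompson_F_def
proof (rule Homeo.presented_group_iso[OF X])
  let ?ev = "eval_word Homeo_plus X"
  have Xc [simp]: "X i \<in> carrier Homeo_plus" for i using X by blast
  have Xi: "inv\<^bsub>Homeo_plus\<^esub> (X i) \<circ> X i = id" for i
    using Homeo.l_inv[OF Xc, of i] by simp
  show R: "?ev u = ?ev v" if r: "(u, v) \<in> Thompson_rels" for u v
  proof -
    obtain i j where uv: "u = [(i, False), (j, True), (i, True)]" "v = [(j + 1, True)]" "i < j"
      using r by blast
    have "?ev u = inv\<^bsub>Homeo_plus\<^esub> (X i) \<circ> (X j \<circ> X i)" by (simp add: uv)
    also have "\<dots> = (inv\<^bsub>Homeo_plus\<^esub> (X i) \<circ> X i) \<circ> X (Suc j)"
      by (simp add: rel[OF uv(3)] comp_assoc)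
    also have "\<dots> = ?ev v" by (simp add: uv Xi)
    finally show ?thesis .
  qed
  have cong: "?ev u = ?ev v" if "u \<approx>\<^sub>F v" for u v
    using Homeo.eval_word_cong[OF X R that] .
  have pos_le: "?ev (pos p) t \<le> t" for p t
    by (induction p) (auto intro: order.trans[OF le])
  have fixes_pt: "?ev (pos p) t = t" if "\<forall>j\<in>set p. X j t = t" for p t
    using that by (induction p) auto
  \<comment> \<open>The rightmost letter acts first. The letters after the last \<open>k\<close> fix
    \<open>t\<close>, that \<open>k\<close> moves it down, and no further factor can move it up
    again.\<close>
  have less: "?ev (pos p) t < t"
    if "k \<in> set p" "\<forall>j\<in>set p. k \<le> j" "X k t < t" "\<forall>j>k. X j t = t" for p k t
    using that(1,2)
  proof (induction p)
    case (Cons j p)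
    show ?case
    proof (cases "k \<in> set p")
      case True
      then have "?ev (pos p) t < t" using Cons by simp
      then show ?thesis using le[of j "?ev (pos p) t"] by simp
    next
      case False
      then have "\<forall>i\<in>set p. X i t = t" using Cons.prems that(4) by (metis le_neq_implies_less list.set_intros(2))
      then have "?ev (pos p) t = t" by (rule fixes_pt)
      then show ?thesis using False Cons.prems(1) that(3) by simp
    qed
  qed simp
  have pos_inj: "pos p \<approx>\<^sub>F pos q" if "?ev (pos p) = ?ev (pos q)" for p q
    using that
  proof (induction "length p" arbitrary: p q rule: less_induct)
    case less': less
    show ?case
    proof (cases "p = [] \<and> q = []")
      case False
      define k where "k = Min (set p \<union> set q)"
      have min: "\<forall>j\<in>set p. k \<le> j" "\<forall>j\<in>set q. k \<le> j" and "k \<in> set p \<union> set q"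
        using False Min_in[of "set p \<union> set q"] unfolding k_def by auto
      obtain t where t: "X k t < t" "\<forall>j>k. X j t = t" using moves by blast
      \<comment> \<open>Occurrence of the least letter is visible in the map, so both words contain
        \<open>k\<close> and it can be cancelled from both.\<close>
      have iff: "k \<in> set r \<longleftrightarrow> ?ev (pos r) t < t" if "\<forall>j\<in>set r. k \<le> j" for r
      proof (cases "k \<in> set r")
        case False
        then have "\<forall>j\<in>set r. X j t = t" using that t(2) by (metis le_neq_implies_less)
        then show ?thesis using fixes_pt False by simp
      qed (use less that t in blast)
      have k: "k \<in> set p" "k \<in> set q"
        using iff min less'.prems \<open>k \<in> set p \<union> set q\<close> by auto
      obtain p' where p': "length p = Suc (length p')" "pos p \<approx>\<^sub>F pos (k # p')"
        using thompson_min_first k(1) min(1) by blast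
      obtain q' where q': "pos q \<approx>\<^sub>F pos (k # q')"
        using thompson_min_first k(2) min(2) by blast
      have "X k \<circ> ?ev (pos p') = X k \<circ> ?ev (pos q')"
        using cong[OF p'(2)] cong[OF q'] less'.prems by simp
      then have "?ev (pos p') = ?ev (pos q')"
        using strict_mono_eq[OF Homeo_plus_strict_mono[OF Xc]] by (simp add: fun_eq_iff)
      then have "pos p' \<approx>\<^sub>F pos q'" using less'.hyps p'(1) by simp
      then have "pos (k # p') \<approx>\<^sub>F pos (k # q')"
        using word_eq.append[OF word_eq.refl, of _ "pos p'" "pos q'" "[(k, True)]"] by simp
      then show ?thesis using p'(2) q' by (blast intro: word_eq.sym word_eq.trans)
    qed (simp add: word_eq.refl)
  qed
  fix w assume w: "?ev w = \<one>\<^bsub>Homeo_plus\<^esub>"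
  obtain p q where pq: "w \<approx>\<^sub>F pos p @ neg q" using thompson_fraction by blast
  \<comment> \<open>Since \<open>neg q\<close> is inverse to \<open>pos (rev q)\<close>, triviality
    of the fraction becomes equality of two positive words.\<close>
  have inv: "pos (rev q) @ neg q \<approx>\<^sub>F []"
    using word_eq_left_inverse[of Thompson_rels "neg q"] by (simp add: rev_map comp_def)
  have "?ev (pos p) \<circ> ?ev (neg q) = ?ev (pos (rev q)) \<circ> ?ev (neg q)"
    using cong[OF pq] cong[OF inv] w Homeo.eval_word_append[OF X] by simp
  then have "?ev (pos p) = ?ev (pos (rev q))"
    using Homeo.right_cancel Homeo.eval_word_closed[OF X] by (metis Homeo_plus_mult)
  then have "pos p @ neg q \<approx>\<^sub>F pos (rev q) @ neg q"
    by (intro word_eq.append pos_inj word_eq.refl)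
  then show "w \<approx>\<^sub>F []" using pq inv by (blast intro: word_eq.trans)
qed

section \<open>Two-chain groups\<close>

text \<open>Here \<open>g\<^sub>0\<close> acts as \<open>(g f)\<^sup>-\<^sup>1\<close> and \<open>g\<^sub>1\<close> as \<open>g\<^sup>-\<^sup>1\<close>. The inequality \<open>fast\<close> puts the supports of
  \<open>g\<^sub>2, g\<^sub>3, \<dots>\<close> to the right of \<open>c\<close>, where \<open>g f\<close> and \<open>g\<close> agree.\<close>

lemma two_chain_generates_Thompson_F:
  assumes f: "f \<in> carrier Homeo_plus" "\<And>t. t \<le> f t" "supp f = {a<..<c}"
    and g: "g \<in> carrier Homeo_plus" "\<And>t. t \<le> g t" "supp g = {b<..<d}"
    and ab: "a < b" "b < c" "c < d" and fast: "c \<le> g (f b)"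
  shows "Homeo_plus\<lparr>carrier := generate Homeo_plus {f, g}\<rparr> \<cong> Thompson_F"
proof -
  let ?H = "Homeo_plus"
  define A where "A = g \<circ> f"
  define A' where "A' = inv\<^bsub>?H\<^esub> A"
  define g' where "g' = inv\<^bsub>?H\<^esub> g"
  \<comment> \<open>The conjugate \<open>Y m\<close> of \<open>g'\<close> by \<open>A ^^ m\<close>
    plays the part of the generator with index \<open>Suc m\<close>; index 0 is taken by
    \<open>A'\<close>.\<close>
  define Y where "Y = rec_nat g' (\<lambda>_ h. A \<circ> h \<circ> A')"
  define X where "X i = (case i of 0 \<Rightarrow> A' | Suc m \<Rightarrow> Y m)" for i
  \<comment> \<open>The left end of the support of \<open>Y m\<close>.\<close>
  define \<beta> where "\<beta> m = (A ^^ m) b" for m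
  have Y_0 [simp]: "Y 0 = g'" and Y_Suc [simp]: "Y (Suc m) = A \<circ> Y m \<circ> A'" for m
    by (simp_all add: Y_def)
  have X_0 [simp]: "X 0 = A'" and X_Suc [simp]: "X (Suc m) = Y m" for m
    by (simp_all add: X_def)
  have A_carrier: "A \<in> carrier ?H"
    using Homeo.m_closed[OF g(1) f(1)] by (simp add: A_def)
  have carrier: "A' \<in> carrier ?H" "g' \<in> carrier ?H"
    using A_carrier g(1) by (auto simp: A'_def g'_def)
  have AA' [simp]: "A (A' t) = t" "A' (A t) = t" for t
    using A_carrier by (simp_all add: A'_def)
  have gg' [simp]: "g (g' t) = t" "g' (g t) = t" for t
    using g(1) by (simp_all add: g'_def)
  have f_id: "f t = t" if "t \<le> a \<or> c \<le> t" for t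
    using f(3) that unfolding supp_def by (metis (mono_tags, lifting) greaterThanLessThan_iff mem_Collect_eq not_le)
  have g_id: "g t = t" if "t \<le> b \<or> d \<le> t" for t
    using g(3) that unfolding supp_def by (metis (mono_tags, lifting) greaterThanLessThan_iff mem_Collect_eq not_le)
  have f_less: "t < f t" if "a < t" "t < c" for t
    using f(2)[of t] f(3) that unfolding supp_def by (metis (mono_tags, lifting) greaterThanLessThan_iff mem_Collect_eq order_le_less)
  have g_less: "t < g t" if "b < t" "t < d" for t
    using g(2)[of t] g(3) that unfolding supp_def by (metis (mono_tags, lifting) greaterThanLessThan_iff mem_Collect_eq order_le_less)
  note mono_A = strict_mono_less_eq[OF Homeo_plus_strict_mono[OF A_carrier]]
    strict_mono_less[OF Homeo_plus_strict_mono[OF A_carrier]]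
  note mono_f = strict_mono_less_eq[OF Homeo_plus_strict_mono[OF f(1)]]
  note mono_g = strict_mono_less_eq[OF Homeo_plus_strict_mono[OF g(1)]]
    strict_mono_less[OF Homeo_plus_strict_mono[OF g(1)]]
  have A_ge: "t \<le> A t" for t
    using order.trans[OF f(2) g(2)] by (simp add: A_def)
  have A'_le: "A' t \<le> t" for t
    using A_ge[of "A' t"] by simp
  have g'_le: "g' t \<le> t" for t
    using g(2)[of "g' t"] by simp
  have \<beta>_Suc: "\<beta> (Suc m) = A (\<beta> m)" for m
    by (simp add: \<beta>_def)
  have \<beta>_1: "c \<le> \<beta> (Suc 0)"
    using fast by (simp add: \<beta>_def A_def)
  have "\<beta> m \<le> \<beta> (Suc m)" for m
    by (simp add: \<beta>_Suc A_ge)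
  then have \<beta>_mono: "\<beta> i \<le> \<beta> j" if "i \<le> j" for i j
    using that lift_Suc_mono_le by blast
  have Y_carrier: "Y m \<in> carrier ?H" for m
  proof (induction m)
    case (Suc m)
    have "A \<otimes>\<^bsub>?H\<^esub> Y m \<otimes>\<^bsub>?H\<^esub> A' \<in> carrier ?H"
      by (intro Homeo.m_closed A_carrier carrier Suc)
    then show ?case by (simp add: comp_def)
  qed (simp add: carrier)
  have Y_id: "Y m t = t" if "t \<le> \<beta> m" for m t
    using that
  proof (induction m arbitrary: t)
    case 0
    then have "g t = t" using g_id by (simp add: \<beta>_def)
    then show ?case using gg'(2)[of t] by simp
  next
    case (Suc m)
    then have "A' t \<le> \<beta> m" using mono_A(1)[of "A' t" "\<beta> m"] by (simp add: \<beta>_Suc)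
    then show ?case using Suc.IH by simp
  qed
  have Y_le: "Y m t \<le> t" for m t
  proof (induction m arbitrary: t)
    case (Suc m)
    then show ?case using mono_A(1)[of "Y m (A' t)" "A' t"] by simp
  qed (simp add: g'_le)
  \<comment> \<open>By \<open>fast\<close>, \<open>Y (Suc m)\<close> lives to the right of
    \<open>c\<close>, while \<open>f\<close> lives to the left of it.\<close>
  have f_Y: "f (Y (Suc m) t) = Y (Suc m) (f t)" for m t
  proof -
    have c: "c \<le> \<beta> (Suc m)" using \<beta>_1 \<beta>_mono[of "Suc 0" "Suc m"] by simp
    show ?thesis
    proof (cases "t \<le> c")
      case True
      then have "f t \<le> c" using mono_f[of t c] f_id[of c] by simp
      then show ?thesis using True c Y_id by (metis order.trans)
    next
      case False
      then have "c \<le> Y (Suc m) t"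
        using strict_mono_less_eq[OF Homeo_plus_strict_mono[OF Y_carrier], of "Suc m" c t] Y_id[OF c]
        by linarith
      then show ?thesis using False f_id by simp
    qed
  qed
  \<comment> \<open>For \<open>0 < m\<close>, \<open>f\<close> commutes with \<open>Y m\<close>, so
    conjugation by \<open>A\<close> and by \<open>g\<close> has the same effect on it; this is the
    case \<open>l = 0\<close>. Conjugating by \<open>A\<close> then raises both indices.\<close>
  have Y_rel: "Y m \<circ> Y l = Y l \<circ> Y (Suc m)" if "l < m" for l m
    using that
  proof (induction l arbitrary: m)
    case 0
    then obtain m' where m: "m = Suc m'" by (cases m) auto
    have "g (Y m s) = Y (Suc m) (g s)" for s
    proof -
      obtain r where r: "s = f r"
        using f(1) by (metis Homeo_plus_inv_apply(1))
      have "Y (Suc m) (g s) = A (Y m (A' (A r)))" by (simp add: A_def r)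
      also have "\<dots> = g (f (Y m r))" unfolding AA' by (simp add: A_def)
      also have "\<dots> = g (Y m s)" unfolding m f_Y r ..
      finally show ?thesis ..
    qed
    then have "Y m (g' t) = g' (Y (Suc m) t)" for t
      by (metis gg')
    then show ?case unfolding Y_0 comp_def by (rule ext)
  next
    case (Suc l)
    then obtain m' where m: "m = Suc m'" "l < m'" by (cases m) auto
    have "Y m' (Y l t) = Y l (Y (Suc m') t)" for t
      using Suc.IH[OF m(2)] by (metis comp_apply)
    then show ?case by (simp add: m fun_eq_iff)
  qed
  have X_range: "range X \<subseteq> carrier ?H"
    using carrier Y_carrier by (auto simp: X_def split: nat.split)
  have iso: "?H\<lparr>carrier := generate ?H (range X)\<rparr> \<cong> Thompson_F"
  proof (rule Thompson_F_criterion[OF X_range])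
    fix i j :: nat assume "i < j"
    then show "X j \<circ> X i = X i \<circ> X (Suc j)"
    proof (cases i)
      case 0
      then obtain m where "j = Suc m" using \<open>i < j\<close> gr0_implies_Suc by blast
      then show ?thesis using 0 by (simp add: fun_eq_iff)
    next
      case (Suc l)
      then obtain m where "j = Suc m" "l < m" using \<open>i < j\<close> by (cases j) auto
      then show ?thesis using Y_rel Suc by (simp del: Y_Suc)
    qed
  next
    fix i t show "X i t \<le> t" using A'_le Y_le by (cases i) auto
  next
    fix k show "\<exists>t. X k t < t \<and> (\<forall>j>k. X j t = t)"
    proof (cases k)
      case 0
      \<comment> \<open>Such a point is moved by \<open>f\<close> and lies left of the supports of
        all \<open>Y m\<close>.\<close>
      obtain t where t: "a < t" "t < b" using dense ab(1) by blast
      have "t < f t" using t ab by (intro f_less) simp_all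
      also have "f t \<le> A t" by (simp add: A_def g(2))
      finally have "A' t < t" using mono_A(2)[of "A' t" t] unfolding AA' by blast
      moreover have "X j t = t" if j: "0 < j" for j
      proof -
        obtain m where m: "j = Suc m" using j gr0_implies_Suc by blast
        have "b \<le> \<beta> m" using \<beta>_mono[of 0 m] by (simp add: \<beta>_def)
        then show ?thesis using t(2) m by (simp add: Y_id)
      qed
      ultimately show ?thesis using 0 by auto
    next
      case (Suc m)
      \<comment> \<open>The map \<open>g\<close> moves \<open>s\<close>, so \<open>Y m\<close> moves
        its image under \<open>A ^^ m\<close>. As \<open>s < c\<close> and \<open>c\<close> is at
        most \<open>A b\<close>, this image lies left of the supports of all later
        generators.\<close>
      obtain s where s: "b < s" "s < c" using dense ab(2) by blast
      define t where "t = (A ^^ m) s"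
      have "g' s < s" using g_less[of s] s ab(3) mono_g(2)[of "g' s" s] by simp
      moreover have "Y m ((A ^^ m) u) = (A ^^ m) (g' u)" for u by (induction m) simp_all
      moreover have "(A ^^ m) u < (A ^^ m) v \<longleftrightarrow> u < v" "(A ^^ m) u \<le> (A ^^ m) v \<longleftrightarrow> u \<le> v" for u v
        by (induction m) (simp_all add: mono_A)
      ultimately have "Y m t < t" and "t \<le> \<beta> (Suc m)"
        using s \<beta>_1 by (simp_all add: t_def \<beta>_def funpow_swap1[of A])
      moreover have "X j t = t" if j: "j > k" for j
      proof -
        obtain l where l: "j = Suc l" "Suc m \<le> l" using j Suc by (cases j) auto
        have "t \<le> \<beta> l" using \<open>t \<le> \<beta> (Suc m)\<close> \<beta>_mono[OF l(2)] by (rule order.trans)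
        then show ?thesis unfolding l(1) X_Suc by (rule Y_id)
      qed
      ultimately show ?thesis using Suc by auto
    qed
  qed
  have fg: "{f, g} \<subseteq> carrier ?H" using f g by blast
  have gen: "subgroup (generate ?H {f, g}) ?H" "subgroup (generate ?H (range X)) ?H"
    using Homeo.generate_is_subgroup[OF fg] Homeo.generate_is_subgroup[OF X_range] by blast+
  have gen_eq: "generate ?H (range X) = generate ?H {f, g}"
  proof (intro equalityI Homeo.generate_subgroup_incl gen)
    have "f \<in> generate ?H {f, g}" "g \<in> generate ?H {f, g}" by (auto intro: generate.incl)
    then have A: "A \<in> generate ?H {f, g}" and g': "g' \<in> generate ?H {f, g}"
      using subgroup.m_closed[OF gen(1), of g f] subgroup.m_inv_closed[OF gen(1)]
      by (simp_all add: A_def g'_def)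
    then have A': "A' \<in> generate ?H {f, g}"
      using subgroup.m_inv_closed[OF gen(1)] by (simp add: A'_def)
    have "Y m \<in> generate ?H {f, g}" for m
    proof (induction m)
      case (Suc m)
      then show ?case
        using subgroup.m_closed[OF gen(1) subgroup.m_closed[OF gen(1) A] A', of "Y m"]
        by (simp add: comp_def)
    qed (simp add: g')
    then show "range X \<subseteq> generate ?H {f, g}" using A' by (auto simp: X_def split: nat.split)
  next
    have X01: "A' \<in> generate ?H (range X)" "g' \<in> generate ?H (range X)"
      by (metis X_0 X_Suc Y_0 generate.incl rangeI)+
    have "g' \<circ> inv\<^bsub>?H\<^esub> A' \<in> generate ?H (range X)"
      using subgroup.m_closed[OF gen(2) X01(2) subgroup.m_inv_closed[OF gen(2) X01(1)]] by simp
    moreover have "g' \<circ> inv\<^bsub>?H\<^esub> A' = f"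
      unfolding A'_def Homeo.inv_inv[OF A_carrier] by (auto simp: A_def fun_eq_iff)
    moreover have "inv\<^bsub>?H\<^esub> g' = g" using g(1) by (simp add: g'_def)
    ultimately show "{f, g} \<subseteq> generate ?H (range X)"
      using subgroup.m_inv_closed[OF gen(2) X01(2)] by simp
  qed
  show ?thesis using iso unfolding gen_eq .
qed

section \<open>A criterion for non-simplicity\<close>

text \<open>The pointwise stabilizer of \<open>C\<close> is the kernel of the action of
  \<open>D\<close> on \<open>C\<close>, hence normal; \<open>h\<close> shows that it is proper and
  \<open>k\<close> that it is nontrivial.\<close>

lemma not_simple_if_pointwise_stabilizer:
  assumes D: "subgroup D Homeo_plus"
    and C: "\<And>g x. g \<in> D \<Longrightarrow> x \<in> C \<Longrightarrow> g x \<in> C"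
    and h: "h \<in> D" "x \<in> C" "h x \<noteq> x"
    and k: "k \<in> D" "k \<noteq> id" "\<And>y. y \<in> C \<Longrightarrow> k y = y"
  shows "\<not> is_simple_group (Homeo_plus\<lparr>carrier := D\<rparr>)"
proof -
  let ?D = "Homeo_plus\<lparr>carrier := D\<rparr>"
  let ?N = "{g \<in> D. \<forall>y\<in>C. g y = y}"
  have D_carrier: "g \<in> carrier Homeo_plus" if "g \<in> D" for g
    using subgroup.mem_carrier[OF D that] .
  interpret D: group ?D by (rule Homeo.subgroup_imp_group[OF D])
  have inv: "inv\<^bsub>?D\<^esub> g = inv\<^bsub>Homeo_plus\<^esub> g" if "g \<in> D" for g
    using Homeo.m_inv_consistent[OF D that] .
  have "subgroup ?N ?D"
  proof (rule D.subgroupI)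
    fix g assume "g \<in> ?N"
    then show "inv\<^bsub>?D\<^esub> g \<in> ?N"
      using subgroup.m_inv_closed[OF D] inv by simp (metis D_carrier Homeo_plus_inv_apply(2))
  next
    fix g g' assume "g \<in> ?N" "g' \<in> ?N"
    then show "g \<otimes>\<^bsub>?D\<^esub> g' \<in> ?N" using subgroup.m_closed[OF D, of g g'] by simp
  qed (use k in auto)
  moreover have "g \<otimes>\<^bsub>?D\<^esub> n \<otimes>\<^bsub>?D\<^esub> inv\<^bsub>?D\<^esub> g \<in> ?N" if gn: "g \<in> D" "n \<in> ?N" for g n
  proof -
    have g': "inv\<^bsub>Homeo_plus\<^esub> g \<in> D" using subgroup.m_inv_closed[OF D gn(1)] .
    have "g \<circ> n \<circ> inv\<^bsub>Homeo_plus\<^esub> g \<in> D"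
      using subgroup.m_closed[OF D subgroup.m_closed[OF D gn(1)] g', of n] gn(2) by simp
    moreover have "g (n ((inv\<^bsub>Homeo_plus\<^esub> g) y)) = y" if "y \<in> C" for y
      using C[OF g' that] gn D_carrier by simp
    ultimately show ?thesis by (simp add: inv[OF gn(1)])
  qed
  ultimately have "?N \<lhd> ?D" by (intro D.normal_invI) auto
  moreover have "?N \<noteq> carrier ?D" "?N \<noteq> {\<one>\<^bsub>?D\<^esub>}" using h k by auto
  ultimately show ?thesis unfolding is_simple_group_def by blast
qed

section \<open>The generating map\<close>

text \<open>The map \<open>base_map\<close> differs from \<open>pl_map\<close> only in the gap \<open>(1, 2)\<close>, which both send onto the gap
  \<open>(3, 6)\<close>. It is a lattice polynomial in increasing affine maps, so exchanging \<open>min\<close> with \<open>max\<close>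
  and each affine map with its inverse yields the inverse.\<close>

definition base_map :: "real \<Rightarrow> real" where
  "base_map x = max x (min (max (3 * x) (min (4 * x - 1) (2 * x + 2))) (min (x + 12) (x / 3 + 18)))"

definition base_inv :: "real \<Rightarrow> real" where
  "base_inv y = min y (max (min (y / 3) (max ((y + 1) / 4) ((y - 2) / 2))) (max (y - 12) (3 * y - 54)))"

definition pl_map :: "real \<Rightarrow> real" where
  "pl_map x = max x (min (3 * x) (min (x + 12) (x / 3 + 18)))"

definition pl_inv :: "real \<Rightarrow> real" where
  "pl_inv y = min y (max (y / 3) (max (y - 12) (3 * y - 54)))"

lemma pl_map_pieces:
  "x \<le> 0 \<Longrightarrow> pl_map x = x" "0 \<le> x \<Longrightarrow> x \<le> 6 \<Longrightarrow> pl_map x = 3 * x"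
  "6 \<le> x \<Longrightarrow> x \<le> 9 \<Longrightarrow> pl_map x = x + 12" "9 \<le> x \<Longrightarrow> x \<le> 27 \<Longrightarrow> pl_map x = x / 3 + 18"
  "27 \<le> x \<Longrightarrow> pl_map x = x"
  unfolding pl_map_def by auto

lemma pl_inv_pieces:
  "y \<le> 0 \<Longrightarrow> pl_inv y = y" "0 \<le> y \<Longrightarrow> y \<le> 18 \<Longrightarrow> pl_inv y = y / 3"
  "18 \<le> y \<Longrightarrow> y \<le> 21 \<Longrightarrow> pl_inv y = y - 12" "21 \<le> y \<Longrightarrow> y \<le> 27 \<Longrightarrow> pl_inv y = 3 * y - 54"
  "27 \<le> y \<Longrightarrow> pl_inv y = y"
  unfolding pl_inv_def by auto

lemma base_map_pieces:
  "1 \<le> x \<Longrightarrow> 2 * x \<le> 3 \<Longrightarrow> base_map x = 4 * x - 1" "3 \<le> 2 * x \<Longrightarrow> x \<le> 2 \<Longrightarrow> base_map x = 2 * x + 2"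
  "x \<le> 1 \<or> 2 \<le> x \<Longrightarrow> base_map x = pl_map x"
  unfolding base_map_def pl_map_def by auto

lemma base_inv_pieces:
  "3 \<le> y \<Longrightarrow> y \<le> 5 \<Longrightarrow> base_inv y = (y + 1) / 4" "5 \<le> y \<Longrightarrow> y \<le> 6 \<Longrightarrow> base_inv y = (y - 2) / 2"
  "y \<le> 3 \<or> 6 \<le> y \<Longrightarrow> base_inv y = pl_inv y"
  unfolding base_inv_def pl_inv_def by auto

lemma pl_map_ge: "x \<le> pl_map x" and pl_inv_le: "pl_inv x \<le> x"
  unfolding pl_map_def pl_inv_def by auto

lemma pl_map_inverse: "pl_map (pl_inv y) = y" "pl_inv (pl_map x) = x"
proof -
  consider "x \<le> 0" | "0 \<le> x" "x \<le> 6" | "6 \<le> x" "x \<le> 9" | "9 \<le> x" "x \<le> 27" | "27 \<le> x" by linarith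
  then show "pl_inv (pl_map x) = x" by cases (simp_all add: pl_map_pieces pl_inv_pieces diff_divide_distrib)
  consider "y \<le> 0" | "0 \<le> y" "y \<le> 18" | "18 \<le> y" "y \<le> 21" | "21 \<le> y" "y \<le> 27" | "27 \<le> y" by linarith
  then show "pl_map (pl_inv y) = y" by cases (simp_all add: pl_map_pieces pl_inv_pieces diff_divide_distrib)
qed

lemma strict_mono_pl_map: "strict_mono pl_map"
  unfolding pl_map_def by (intro strict_monoI) (auto simp: max_def min_def)

lemma strict_mono_base_map: "strict_mono base_map"
  unfolding base_map_def by (intro strict_monoI) (auto simp: max_def min_def)

lemma base_map_inverse: "base_map (base_inv y) = y" "base_inv (base_map x) = x"
proof -
  consider "1 \<le> x" "2 * x \<le> 3" | "3 \<le> 2 * x" "x \<le> 2" | "x \<le> 1" | "2 \<le> x" by linarith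
  then show "base_inv (base_map x) = x"
  proof cases
    case 3
    \<comment> \<open>The image stays to the left of the gap \<open>(3, 6)\<close>, where
      \<open>base_inv\<close> and \<open>pl_inv\<close> agree.\<close>
    have "pl_map x \<le> 3" using 3 unfolding pl_map_def by auto
    then show ?thesis using 3 by (simp add: base_map_pieces base_inv_pieces pl_map_inverse)
  next
    case 4
    have "6 \<le> pl_map x" using 4 unfolding pl_map_def by (auto simp: max_def min_def)
    then show ?thesis using 4 by (simp add: base_map_pieces base_inv_pieces pl_map_inverse)
  qed (simp_all add: base_map_pieces base_inv_pieces add_divide_distrib diff_divide_distrib)
  consider "3 \<le> y" "y \<le> 5" | "5 \<le> y" "y \<le> 6" | "y \<le> 3" | "6 \<le> y" by linarith
  then show "base_map (base_inv y) = y"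
  proof cases
    case 3
    have "pl_inv y \<le> 1" using 3 unfolding pl_inv_def by (auto simp: max_def min_def)
    then show ?thesis using 3 by (simp add: base_map_pieces base_inv_pieces pl_map_inverse)
  next
    case 4
    have "2 \<le> pl_inv y" using 4 unfolding pl_inv_def by (auto simp: max_def min_def)
    then show ?thesis using 4 by (simp add: base_map_pieces base_inv_pieces pl_map_inverse)
  qed (simp_all add: base_map_pieces base_inv_pieces add_divide_distrib diff_divide_distrib)
qed

text \<open>The relation \<open>F\<^sub>2 F\<^sub>1 [F\<^sub>1, F\<^sub>2\<^sup>-\<^sup>1] (F\<^sub>2 F\<^sub>1)\<^sup>-\<^sup>1 = F\<^sub>3\<^sup>-\<^sup>1 [F\<^sub>2, F\<^sub>3\<^sup>-\<^sup>1] F\<^sub>3\<close> between consecutive translates, with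
  \<open>F\<^sub>2 F\<^sub>1\<close> moved to the right-hand side: both sides of the former are the copy of \<open>pl_map\<close> on \<open>[36, 39]\<close> scaled by \<open>1/9\<close>.\<close>

lemma pl_relation:
  fixes z :: real
  defines "F \<equiv> \<lambda>s x. s + pl_map (x - s)" and "I \<equiv> \<lambda>s x. s + pl_inv (x - s)"
  shows "F 18 (F 0 (F 0 (I 18 (I 0 (F 18 z))))) = I 36 (F 18 (I 36 (I 18 (F 36 (F 36 (F 18 (F 0 z)))))))"
proof -
  have FI: "F s (I s x) = x" "I s (F s x) = x" for s x
    by (simp_all add: F_def I_def pl_map_inverse)
  have fix_F: "F s x = x" and fix_I: "I s x = x" if "x \<le> s \<or> s + 27 \<le> x" for s x
    using that by (auto simp: F_def I_def pl_map_pieces pl_inv_pieces)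
  have le: "I s x \<le> x" "x \<le> F s x" for s x
    using pl_map_ge[of "x - s"] pl_inv_le[of "x - s"] by (auto simp: F_def I_def)
  have mono: "x \<le> y \<Longrightarrow> F s x \<le> F s y" for s x y
    using strict_mono_pl_map by (simp add: F_def strict_mono_less_eq)
  \<comment> \<open>To the left of 18 and to the right of 27 the commutators act trivially and both
    sides equal \<open>F 18 (F 0 z)\<close>. In between, the subdivision makes every factor affine
    on each interval.\<close>
  consider "z \<le> 18" | "18 \<le> z" "z \<le> 19" | "19 \<le> z" "z \<le> 20" | "20 \<le> z" "z \<le> 21"
    | "21 \<le> z" "z \<le> 24" | "24 \<le> z" "z \<le> 27" | "27 \<le> z" by linarith
  then show ?thesis
  proof cases
    case 1
    have F018: "F 0 18 = 24" "F 18 24 = 36" by (simp_all add: F_def pl_map_pieces)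
    have "F 18 (F 0 z) \<le> 36" using 1 mono F018 by metis
    then show ?thesis using 1 le(1)[of 0 z] le(1)[of 18 "F 18 (F 0 z)"]
      by (simp add: fix_F fix_I FI)
  next
    case 7
    have F18: "F 18 27 = 39" "F 36 39 = 45" by (simp_all add: F_def pl_map_pieces)
    have "45 \<le> F 36 (F 18 z)" using 7 mono F18 by metis
    then show ?thesis using 7 le(2)[of z 18] le(2)[of "F 36 (F 18 z)" 36]
      by (simp add: fix_F fix_I FI)
  qed (simp_all add: F_def I_def pl_map_pieces pl_inv_pieces add_divide_distrib diff_divide_distrib)
qed

section \<open>An invariant set\<close>

text \<open>A countable dense subset of the middle-thirds set of \<open>[0, 9]\<close>, which serves in its place.\<close>

inductive_set cantor_points :: "real set" where
  zero: "0 \<in> cantor_points"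
| left: "x \<in> cantor_points \<Longrightarrow> x / 3 \<in> cantor_points"
| right: "x \<in> cantor_points \<Longrightarrow> x / 3 + 6 \<in> cantor_points"

definition cantor_chain :: "real set" where
  "cantor_chain = {x. \<exists>m::int. x - 18 * of_int m \<in> cantor_points}"

lemma cantor_points_range:
  "x \<in> cantor_points \<Longrightarrow> 0 \<le> x \<and> x \<le> 1 \<or> 2 \<le> x \<and> x \<le> 3 \<or> 6 \<le> x \<and> x \<le> 9"
  by (induction rule: cantor_points.induct) auto

text \<open>The rule \<open>right\<close> only yields points from 6 on, so it cannot have produced
  \<open>x / 3\<close>. In \<open>cantor_points_right_iff\<close> the rule \<open>left\<close> is
  excluded likewise, as it reaches only up to 3.\<close>

lemma cantor_points_left_iff: "x / 3 \<in> cantor_points \<longleftrightarrow> x \<in> cantor_points" if "x < 18"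
proof
  assume "x / 3 \<in> cantor_points"
  then show "x \<in> cantor_points"
  proof cases
    case (right y)
    then show ?thesis using cantor_points_range[of y] that by auto
  qed (auto intro: cantor_points.zero)
qed (rule cantor_points.left)

lemma cantor_points_right_iff: "x / 3 + 6 \<in> cantor_points \<longleftrightarrow> x \<in> cantor_points" if "-9 < x"
proof
  assume "x / 3 + 6 \<in> cantor_points"
  then show "x \<in> cantor_points"
  proof cases
    case (left y)
    then show ?thesis using cantor_points_range[of y] that by auto
  qed (use that in auto)
qed (rule cantor_points.right)

text \<open>Both sides are equivalent to membership of \<open>3 * x\<close>.\<close>

lemma cantor_points_add_6_iff: "x + 6 \<in> cantor_points \<longleftrightarrow> x \<in> cantor_points" if "-3 < x" "x < 6"
  using cantor_points_right_iff[of "3 * x"] cantor_points_left_iff[of "3 * x"] that by simp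

lemma cantor_chainI: "y \<in> cantor_points \<Longrightarrow> x = y + 18 * of_int m \<Longrightarrow> x \<in> cantor_chain"
  unfolding cantor_chain_def by (auto intro!: exI[of _ m])

text \<open>The support \<open>(0, 27)\<close> of \<open>base_map\<close> meets only the blocks in
  \<open>[0, 9]\<close> and \<open>[18, 27]\<close>; the other blocks lie where the map is the
  identity.\<close>

lemma cantor_chain_cases:
  assumes "x \<in> cantor_chain"
  obtains "x \<le> -9" | "36 \<le> x" | "x \<in> cantor_points" | "x - 18 \<in> cantor_points"
proof -
  obtain m :: int where m: "x - 18 * of_int m \<in> cantor_points"
    using assms unfolding cantor_chain_def by blast
  note r = cantor_points_range[OF m]
  consider "m \<le> -1" | "m = 0" | "m = 1" | "2 \<le> m" by linarith
  then show ?thesis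
  proof cases
    case 1
    then have "real_of_int m \<le> -1" by linarith
    then show ?thesis using r that(1) by linarith
  next
    case 4
    then have "2 \<le> real_of_int m" by linarith
    then show ?thesis using r that(2) by linarith
  qed (use m that in auto)
qed

text \<open>The set avoids the gap \<open>(1, 2)\<close>, so the two maps agree on it. The left
  third of the block in \<open>[0, 9]\<close> is expanded onto that block, its right third is
  translated onto the left third of the block in \<open>[18, 27]\<close>, and the latter block is
  contracted onto its own right third.\<close>

lemma base_map_cantor_chain:
  assumes "x \<in> cantor_chain"
  shows "base_map x = pl_map x \<and> base_map x \<in> cantor_chain"
  using assms
proof (cases rule: cantor_chain_cases)
  case 3
  note r = cantor_points_range[OF 3]
  show ?thesis
  proof (cases "x \<le> 3")
    case True
    then have "3 * x \<in> cantor_points" using 3 cantor_points_left_iff[of "3 * x"] by simp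
    then show ?thesis using True r cantor_chainI[of "3 * x" "3 * x" 0]
      by (auto simp: base_map_pieces pl_map_pieces)
  next
    case False
    then have "x - 6 \<in> cantor_points" using 3 r cantor_points_add_6_iff[of "x - 6"] by simp
    then show ?thesis using False r cantor_chainI[of "x - 6" "x + 12" 1]
      by (auto simp: base_map_pieces pl_map_pieces)
  qed
next
  case 4
  note r = cantor_points_range[OF 4]
  have "(x - 18) / 3 + 6 \<in> cantor_points" by (rule cantor_points.right[OF 4])
  from cantor_chainI[OF this, of "x / 3 + 18" 1] show ?thesis
    using r by (auto simp: base_map_pieces pl_map_pieces diff_divide_distrib)
qed (use assms in \<open>auto simp: base_map_pieces pl_map_pieces\<close>)

lemma base_inv_cantor_chain:
  assumes "x \<in> cantor_chain"
  shows "base_inv x = pl_inv x \<and> base_inv x \<in> cantor_chain"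
  using assms
proof (cases rule: cantor_chain_cases)
  case 3
  note r = cantor_points_range[OF 3]
  show ?thesis using cantor_points.left[OF 3] cantor_chainI[of "x / 3" "x / 3" 0] r
    by (auto simp: base_inv_pieces pl_inv_pieces)
next
  case 4
  note r = cantor_points_range[OF 4]
  show ?thesis
  proof (cases "x - 18 \<le> 3")
    case True
    moreover have "18 \<le> x" using r by auto
    ultimately have "x - 12 \<in> cantor_points" using 4 cantor_points_add_6_iff[of "x - 18"] by simp
    then show ?thesis using True r cantor_chainI[of "x - 12" "x - 12" 0]
      by (auto simp: base_inv_pieces pl_inv_pieces)
  next
    case False
    then have "3 * x - 72 \<in> cantor_points"
      using 4 cantor_points_right_iff[of "3 * x - 72"] by (simp add: diff_divide_distrib)
    then show ?thesis using False r cantor_chainI[of "3 * x - 72" "3 * x - 54" 1]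
      by (auto simp: base_inv_pieces pl_inv_pieces)
  qed
qed (use assms in \<open>auto simp: base_inv_pieces pl_inv_pieces\<close>)

lemma cantor_chain_translate: "x - 18 * of_int m \<in> cantor_chain \<longleftrightarrow> x \<in> cantor_chain"
proof -
  have *: "y - 18 * of_int l \<in> cantor_chain" if y: "y \<in> cantor_chain" for y l
  proof -
    obtain j :: int where "y - 18 * of_int j \<in> cantor_points"
      using y unfolding cantor_chain_def by blast
    then show ?thesis by (rule cantor_chainI[of _ _ "j - l"]) (simp add: algebra_simps)
  qed
  show ?thesis using *[of "x - 18 * of_int m" "- m"] * by auto
qed

section \<open>The chain group\<close>

text \<open>Supports have length 27, so steps of 18 make neighbours overlap in length 9 and keep all
  other pairs disjoint.\<close>

definition chain_gen :: "nat \<Rightarrow> real \<Rightarrow> real" where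
  "chain_gen i x = 18 * (real i - 1) + base_map (x - 18 * (real i - 1))"

definition chain_inv :: "nat \<Rightarrow> real \<Rightarrow> real" where
  "chain_inv i x = 18 * (real i - 1) + base_inv (x - 18 * (real i - 1))"

lemma chain_gen_inverse [simp]: "chain_gen i (chain_inv i x) = x" "chain_inv i (chain_gen i x) = x"
  by (simp_all add: chain_gen_def chain_inv_def base_map_inverse)

lemma chain_gen_carrier [simp]: "chain_gen i \<in> carrier Homeo_plus"
proof -
  have "continuous_on UNIV (chain_gen i)" "continuous_on UNIV (chain_inv i)"
    unfolding chain_gen_def chain_inv_def base_map_def base_inv_def
    by (intro continuous_intros; simp)+
  moreover have "surj (chain_gen i)" "surj (chain_inv i)"
    by (rule surjI, rule chain_gen_inverse)+
  ultimately have "homeomorphism UNIV UNIV (chain_gen i) (chain_inv i)"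
    by (simp add: homeomorphism_def)
  moreover have "strict_mono (chain_gen i)"
    using strict_mono_base_map by (auto simp: chain_gen_def strict_mono_def)
  ultimately show ?thesis by (auto simp: Homeo_plus_def)
qed

lemma Homeo_plus_inv_eqI:
  assumes "f \<in> carrier Homeo_plus" "\<And>x. f (g x) = x"
  shows "inv\<^bsub>Homeo_plus\<^esub> f = g"
  using assms Homeo_plus_inv_apply(2)[OF assms(1)] by (metis ext)

lemma inv_chain_gen [simp]: "inv\<^bsub>Homeo_plus\<^esub> (chain_gen i) = chain_inv i"
  by (rule Homeo_plus_inv_eqI) simp_all

lemma chain_gen_ge: "x \<le> chain_gen i x"
  unfolding chain_gen_def base_map_def by auto

lemma supp_chain_gen: "supp (chain_gen i) = {18 * (real i - 1)<..<18 * (real i - 1) + 27}"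
proof -
  have *: "base_map y \<noteq> y \<longleftrightarrow> 0 < y \<and> y < 27" for y
    unfolding base_map_def by (auto simp: max_def min_def)
  have "chain_gen i x \<noteq> x \<longleftrightarrow> 18 * (real i - 1) < x \<and> x < 18 * (real i - 1) + 27" for x
    using *[of "x - 18 * (real i - 1)"] unfolding chain_gen_def by linarith
  then show ?thesis by (simp add: supp_def greaterThanLessThan_eq set_eq_iff)
qed

lemma chain_gen_cantor_chain:
  assumes "x \<in> cantor_chain"
  shows "chain_gen i x \<in> cantor_chain" "chain_inv i x \<in> cantor_chain"
    and "chain_gen i x = 18 * (real i - 1) + pl_map (x - 18 * (real i - 1))"
    and "chain_inv i x = 18 * (real i - 1) + pl_inv (x - 18 * (real i - 1))"
proof -
  define s where "s = 18 * (real i - 1)"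
  have iff: "y - s \<in> cantor_chain \<longleftrightarrow> y \<in> cantor_chain" for y
    using cantor_chain_translate[of y "int i - 1"] by (simp add: s_def)
  then have x: "x - s \<in> cantor_chain" using assms by simp
  note base = base_map_cantor_chain[OF x] base_inv_cantor_chain[OF x]
  show "chain_gen i x \<in> cantor_chain" "chain_inv i x \<in> cantor_chain"
    using base iff[of "s + base_map (x - s)"] iff[of "s + base_inv (x - s)"]
    unfolding chain_gen_def chain_inv_def s_def[symmetric] by auto
  show "chain_gen i x = 18 * (real i - 1) + pl_map (x - 18 * (real i - 1))"
    "chain_inv i x = 18 * (real i - 1) + pl_inv (x - 18 * (real i - 1))"
    using base unfolding chain_gen_def chain_inv_def s_def[symmetric] by simp_all
qed

lemma left_endpoint_greaterThanLessThan: "a < b \<Longrightarrow> left_endpoint {a<..<b} = ereal a"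
  unfolding left_endpoint_def
proof (rule INF_eqI)
  fix y assume "a < b" and y: "\<And>i. i \<in> {a<..<b} \<Longrightarrow> y \<le> ereal i"
  show "y \<le> ereal a"
  proof (rule dense_ge)
    fix z assume z: "ereal a < z"
    obtain r where r: "ereal a < ereal r" "ereal r < min z (ereal b)"
      using ereal_dense2[of "ereal a" "min z (ereal b)"] z \<open>a < b\<close> by auto
    then show "y \<le> z" using y[of r] by (simp add: order.trans less_imp_le)
  qed
qed auto

lemma chain_group_chain_gen:
  assumes "n \<ge> 2"
  shows "chain_group n (generate Homeo_plus (chain_gen ` {1..n}))"
proof -
  have chain: "chain_of_intervals n (\<lambda>i. supp (chain_gen i))"
    unfolding chain_of_intervals_def
  proof (intro conjI ballI allI impI)
    fix i k assume "\<bar>int i - int k\<bar> > 1"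
    then consider "real i + 2 \<le> real k" | "real k + 2 \<le> real i" by linarith
    then show "supp (chain_gen i) \<inter> supp (chain_gen k) = {}"
      by cases (auto simp: supp_chain_gen)
  next
    fix i :: nat
    let ?s = "18 * (real i - 1)"
    \<comment> \<open>Relative to \<open>?s\<close>, 10 lies only in the first support, 20 in both
      and 30 only in the second.\<close>
    have "?s + 10 \<in> supp (chain_gen i)" "?s + 20 \<in> supp (chain_gen i)" "?s + 30 \<notin> supp (chain_gen i)"
      "?s + 10 \<notin> supp (chain_gen (i + 1))" "?s + 20 \<in> supp (chain_gen (i + 1))"
      "?s + 30 \<in> supp (chain_gen (i + 1))"
      by (auto simp: supp_chain_gen)
    then show "supp (chain_gen i) \<noteq> {}" "supp (chain_gen i) \<inter> supp (chain_gen (i + 1)) \<noteq> {}"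
      "supp (chain_gen i) \<inter> supp (chain_gen (i + 1)) \<subset> supp (chain_gen i)"
      "supp (chain_gen i) \<inter> supp (chain_gen (i + 1)) \<subset> supp (chain_gen (i + 1))"
      by blast+
    show "is_interval (supp (chain_gen i) \<inter> supp (chain_gen (i + 1)))"
      by (intro is_interval_Int) (simp_all add: supp_chain_gen is_interval_oo)
  qed (simp_all add: supp_chain_gen is_interval_oo)
  have left: "left_endpoint (supp (chain_gen i)) < left_endpoint (supp (chain_gen (i + 1)))" for i
    by (simp add: supp_chain_gen left_endpoint_greaterThanLessThan)
  have iso: "Homeo_plus\<lparr>carrier := generate Homeo_plus {chain_gen i, chain_gen (i + 1)}\<rparr> \<cong> Thompson_F"
    for i
  proof (rule two_chain_generates_Thompson_F[OF _ chain_gen_ge supp_chain_gen _ chain_gen_ge supp_chain_gen])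
    \<comment> \<open>Relative to the left end of the first support, the point 18 goes to 24 and
      then to 36, beyond 27.\<close>
    show "18 * (real i - 1) + 27 \<le> chain_gen (i + 1) (chain_gen i (18 * (real (i + 1) - 1)))"
      by (simp add: chain_gen_def base_map_def)
  qed auto
  show ?thesis
    unfolding chain_group_def
    by (intro conjI exI[of _ chain_gen] ballI allI impI HOL.refl assms chain left iso
        chain_gen_ge chain_gen_carrier)
qed

theorem proposition4p8:
  fixes n :: nat
  assumes "n \<ge> 3"
  shows "\<exists>G. chain_group n G \<and>
    \<not> is_simple_group (Homeo_plus\<lparr>carrier := derived Homeo_plus G\<rparr>)"
proof -
  define G where "G = generate Homeo_plus (chain_gen ` {1..n})"
  define D where "D = derived Homeo_plus G"
  have chain: "chain_group n G"
    unfolding G_def using assms by (intro chain_group_chain_gen) simp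
  then have sub: "subgroup G Homeo_plus" by (rule chain_group_subgroup)
  have D: "subgroup D Homeo_plus"
    unfolding D_def by (rule Homeo.derived_is_subgroup[OF subgroup.subset[OF sub]])
  have "D \<subseteq> G" unfolding D_def by (rule Homeo.derived_incl[OF subset_refl sub])
  have G_cantor: "g x \<in> cantor_chain" if "g \<in> G" "x \<in> cantor_chain" for g x
    using that unfolding G_def
    by (induction arbitrary: x) (auto simp: chain_gen_cantor_chain(1,2))
  have gen: "chain_gen i \<in> G" "chain_inv i \<in> G" if "i \<in> {1, 2, 3}" for i
  proof -
    show "chain_gen i \<in> G" using that assms unfolding G_def by (intro generate.incl) auto
    then show "chain_inv i \<in> G" using subgroup.m_inv_closed[OF sub] by fastforce
  qed
  have comp: "p \<circ> q \<in> G" if "p \<in> G" "q \<in> G" for p q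
    using subgroup.m_closed[OF sub that] by simp
  have comm: "p \<circ> q \<circ> p' \<circ> q' \<in> D"
    if "p \<in> G" "q \<in> G" "\<And>x. p (p' x) = x" "\<And>x. q (q' x) = x" for p q p' q'
  proof -
    have "inv\<^bsub>Homeo_plus\<^esub> p = p'" "inv\<^bsub>Homeo_plus\<^esub> q = q'"
      using that subgroup.mem_carrier[OF sub] Homeo_plus_inv_eqI by blast+
    then show ?thesis
      unfolding D_def derived_def using that(1,2) by (intro generate.incl) force
  qed
  \<comment> \<open>The commutator of \<open>chain_gen 1\<close> and
    \<open>chain_inv 2\<close>.\<close>
  define h where "h = chain_gen 1 \<circ> chain_inv 2 \<circ> chain_inv 1 \<circ> chain_gen 2"
  define u where "u = chain_inv 1 \<circ> chain_inv 2 \<circ> chain_inv 3"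
  define v where "v = chain_gen 3 \<circ> chain_gen 2 \<circ> chain_gen 1"
  \<comment> \<open>The commutator of \<open>chain_gen 2\<close> and \<open>chain_inv 3\<close>,
    conjugated so that the relation reads \<open>h = r\<close>. Conjugating each factor separately
    displays \<open>r\<close> itself as a commutator.\<close>
  define r where "r = (u \<circ> chain_gen 2 \<circ> v) \<circ> (u \<circ> chain_inv 3 \<circ> v)
    \<circ> (u \<circ> chain_inv 2 \<circ> v) \<circ> (u \<circ> chain_gen 3 \<circ> v)"
  have uv [simp]: "u (v x) = x" "v (u x) = x" for x by (simp_all add: u_def v_def)
  have uv_G: "u \<in> G" "v \<in> G" unfolding u_def v_def by (intro comp gen; simp)+
  have h: "h \<in> D" unfolding h_def by (rule comm) (use gen in simp_all)
  have r: "r \<in> D" unfolding r_def by (rule comm) (use gen comp uv_G in simp_all)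
  have r_apply: "r x = chain_inv 1 (chain_inv 2 (chain_inv 3 (chain_gen 2 (chain_inv 3 (chain_inv 2
    (chain_gen 3 (chain_gen 3 (chain_gen 2 (chain_gen 1 x)))))))))" for x
    unfolding r_def by (simp add: u_def v_def)
  define k where "k = inv\<^bsub>Homeo_plus\<^esub> h \<circ> r"
  have hc: "h \<in> carrier Homeo_plus" using subgroup.mem_carrier[OF D h] .
  have "\<not> is_simple_group (Homeo_plus\<lparr>carrier := D\<rparr>)"
  proof (rule not_simple_if_pointwise_stabilizer[OF D])
    show "g x \<in> cantor_chain" if "g \<in> D" "x \<in> cantor_chain" for g x
      using G_cantor that \<open>D \<subseteq> G\<close> by blast
    show "h \<in> D" by fact
    \<comment> \<open>The left end of the right third of the block in \<open>[18, 27]\<close>;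
      \<open>h\<close> sends it to 26.\<close>
    show "24 \<in> cantor_chain"
      by (rule cantor_chainI[OF cantor_points.right[OF cantor_points.zero], of _ 1]) simp
    show "h 24 \<noteq> 24"
      by (simp add: h_def chain_gen_def chain_inv_def base_map_def base_inv_def)
    show "k \<in> D"
      using subgroup.m_closed[OF D subgroup.m_inv_closed[OF D h] r] by (simp add: k_def)
    \<comment> \<open>The point lies in the gap \<open>(21, 24)\<close>. There \<open>h\<close> uses
      only unperturbed pieces and gives \<open>51 / 2\<close>. Evaluating \<open>r\<close> leads
      through \<open>75 / 2\<close>, the midpoint of the perturbed gap of
      \<open>chain_gen 3\<close>, and gives \<open>77 / 3\<close>.\<close>
    have "h (45 / 2) \<noteq> r (45 / 2)"
      unfolding r_apply by (simp add: h_def chain_gen_def chain_inv_def base_map_def base_inv_def)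
    then have "k (45 / 2) \<noteq> 45 / 2"
      using Homeo_plus_inv_apply(1)[OF hc, of "r (45 / 2)"] unfolding k_def comp_apply by metis
    then show "k \<noteq> id" by auto
    fix x assume x: "x \<in> cantor_chain"
    define P where "P i y = 18 * (real i - 1) + pl_map (y - 18 * (real i - 1))" for i y
    define Q where "Q i y = 18 * (real i - 1) + pl_inv (y - 18 * (real i - 1))" for i y
    \<comment> \<open>As the set is invariant, the perturbed maps in a composite can be replaced one
      after another by the unperturbed ones, to which \<open>pl_relation\<close> applies.\<close>
    have PQ: "chain_gen i y = P i y" "chain_inv i y = Q i y" "P i y \<in> cantor_chain" "Q i y \<in> cantor_chain"
      if "y \<in> cantor_chain" for i y
      using chain_gen_cantor_chain[OF that, of i] by (simp_all add: P_def Q_def)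
    have "P i (Q i y) = y" for i y by (simp add: P_def Q_def pl_map_inverse)
    moreover have "P 2 (P 1 (P 1 (Q 2 (Q 1 (P 2 x))))) = Q 3 (P 2 (Q 3 (Q 2 (P 3 (P 3 (P 2 (P 1 x)))))))"
      using pl_relation[of x] by (simp add: P_def Q_def)
    ultimately have "chain_gen 2 (chain_gen 1 (h x)) = chain_gen 2 (chain_gen 1 (r x))"
      unfolding h_def r_apply by (simp add: x PQ)
    then have "h x = r x" by (metis chain_gen_inverse(2))
    then show "k x = x" by (simp add: k_def hc flip: \<open>h x = r x\<close>)
  qed
  then show ?thesis using chain unfolding D_def by blast
qed

end
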